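(* Let $X=(X,\rho,\mu)$ be a homogeneous space which supports the weak $p$-Poincaré inequality, let $\Omega,\widetilde\Omega\subset X$ be bounded domains, let $1<q\le p<\infty$, and let $\varphi:\Omega\to\widetilde\Omega$ be a bi-measurable homeomorphism generating a bounded composition operator $\varphi^*:S^{1,p}(\widetilde\Omega)\to S^{1,q}(\Omega)$, $\varphi^*(f)=f\circ\varphi$. Then the preimage under $\varphi$ of a set of $p$-capacity zero has $q$-capacity zero: if $\widetilde E\subset\widetilde\Omega$ and $\mathrm{cap}_p(\widetilde E;\widetilde\Omega)=0$, then $\mathrm{cap}_q(\varphi^{-1}(\widetilde E);\Omega)=0$.
   Context: A doubling metric measure space is a metric space $(X,\rho)$ with a Borel regular measure $\mu$ for which every ball has positive finite measure and $\mu(B(x,2r))\le C_\mu\mu(B(x,r))$ for all $x\in X$, $r>0$, with a (smallest) constant $C_\mu\ge1$. A homogeneous space is a doubling metric measure space with $\sigma$-finite measure such that there is $c_1\ge1$ with: for all $x_1,x_2\in X$, $r>0$, if $B(x_1,r)\cap B(x_2,r)\ne\emptyset$ then $B(x_2,r)\subset B(x_1,c_1r)$. A domain is a nonempty connected open set. Bounded domains $\Omega\subset X$ are considered as doubling metric measure spaces with the metric and measure induced from $X$. For a family $\Gamma$ of curves, $\mathrm{mod}_p(\Gamma)=\inf\int\eta^p\,d\mu$ over Borel $\eta\ge0$ with $\int_\gamma\eta\,ds\ge1$ for all locally rectifiable $\gamma\in\Gamma$. A Borel function $g\ge 0$ is a $p$-weak upper gradient of $f$ if $|f(\gamma(a))-f(\gamma(b))|\le\int_\gamma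 g\,ds$ for all rectifiable curves $\gamma:[a,b]\to\Omega$ except a family of zero $p$-module; it is an upper gradient if this holds for all rectifiable curves. If there is a $p$-weak upper gradient in $L^p$, $\nabla_{min}f$ denotes the minimal $p$-weak upper gradient in $L^p$ (unique up to measure zero). $N^{1,p}(\Omega)$ is the space of measurable $f:\Omega\to\mathbb R$ with $f\in L^p(\Omega)$ having a $p$-weak upper gradient in $L^p(\Omega)$. $S^{1,p}(\Omega)$, $1<p<\infty$, is the space of measurable $f:\Omega\to\mathbb R$ with $f\in L^1_{loc}(\Omega)$ and $\nabla_{min}f\in L^p(\Omega)$, with seminorm $\|f\|_{S^{1,p}(\Omega)}=\|\nabla_{min}f\|_{L^p(\Omega)}$. Functions in these spaces are considered up to sets of $p$-capacity zero (quasicontinuous representatives are used). Weak $p$-Poincaré inequality: there are $\sigma>1$ and $C_p$ such that for all balls $B\subset X$, all $f\in L^1(\sigma B)$ and all $p$-weak upper gradients $g$ of $f$ in $\sigma B$, $\frac1{\mu(B)}\int_B|f-f_B|\,d\mu\le C_p\,\mathrm{diam}(B)\left(\frac1{\mu(\sigma B)}\int_{\sigma B}g^p\,d\mu\right)^{1/p}$, where $f_B$ is the mean of $f$ over $B$. A homeomorphism $\varphi:\Omega\to\widetilde\Omega$ is bi-measurable if images under $\varphi$ of sets of $\mu$-measure zero have $\mu$-measure zero (Luzin $N$-property) and preimages of sets of $\mu$-measure zero have $\mu$-measure zero (Luzin $N^{-1}$-property). It generates a bounded composition operator $\varphi^*:S^{1,p}(\widetilde\Omega)\to S^{1,q}(\Omega)$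 if $f\circ\varphi\in S^{1,q}(\Omega)$ for every $f\in S^{1,p}(\widetilde\Omega)$ and there is a constant $C_{p,q}<\infty$ with $\|f\circ\varphi\|_{S^{1,q}(\Omega)}\le C_{p,q}\|f\|_{S^{1,p}(\widetilde\Omega)}$ for all such $f$. Capacity: for compact $F\subset\Omega$, $\mathrm{cap}_p(F;\Omega)=\inf\int_\Omega(\nabla_{min}u)^p\,d\mu$ over $u\in C_0(\Omega)\cap N^{1,p}(\Omega)$ (with $C_0(\Omega)$ the continuous functions with compact support in $\Omega$) with $u\ge1$ on $F$. For open $U\subset \Omega$, $\mathrm{cap}_p(U;\Omega)$ is the supremum of $\mathrm{cap}_p(F;\Omega)$ over compact $F\subset U$. For arbitrary $E\subset\Omega$, the inner capacity is the supremum of $\mathrm{cap}_p(F;\Omega)$ over compact $F\subset E$ and the outer capacity is the infimum of $\mathrm{cap}_p(U;\Omega)$ over open $U$ with $E\subset U\subset\Omega$. If both agree, $E$ is called $p$-capacity measurable and the common value is $\mathrm{cap}_p(E;\Omega)$; in particular $\mathrm{cap}_p(E;\Omega)=0$ means that the outer capacity of $E$ vanishes. *)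

theory Defs
  imports "HOL-Analysis.Analysis"
begin

section \<open>Metric measure spaces\<close>

text \<open>The space \<open>X\<close> is the whole type. A Borel regular (outer) measure is represented by its
  restriction to its measurable sets: a complete measure, defined at least on the Borel sets, each
  of whose measurable sets has a Borel hull of equal measure. By completeness, the sets of measure
  zero are exactly the elements of \<open>null_sets M\<close>.\<close>

definition borel_regular :: "'a::metric_space measure \<Rightarrow> bool" where
  "borel_regular M \<longleftrightarrow> space M = UNIV \<and> complete_measure M \<and> sets borel \<subseteq> sets M \<and>
     (\<forall>A\<in>sets M. \<exists>B\<in>sets borel. A \<subseteq> B \<and> emeasure M B = emeasure M A)"

definition doubling_space :: "'a::metric_space measure \<Rightarrow> bool" where
  "doubling_space M \<longleftrightarrow> borel_regular M \<and>
     (\<forall>x r. r > 0 \<longrightarrow> 0 < emeasure M (ball x r) \<and> emeasure M (ball x r) < \<infinity>) \<and>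
     (\<exists>C\<ge>1. \<forall>x r. r > 0 \<longrightarrow> emeasure M (ball x (2 * r)) \<le> ennreal C * emeasure M (ball x r))"

definition homogeneous_space :: "'a::metric_space measure \<Rightarrow> bool" where
  "homogeneous_space M \<longleftrightarrow> doubling_space M \<and> sigma_finite_measure M \<and>
     (\<exists>c\<ge>1. \<forall>(x1::'a) x2 r. r > 0 \<longrightarrow> ball x1 r \<inter> ball x2 r \<noteq> {} \<longrightarrow> ball x2 r \<subseteq> ball x1 (c * r))"

definition bounded_domain :: "'a::metric_space set \<Rightarrow> bool" where
  "bounded_domain \<Omega> \<longleftrightarrow> \<Omega> \<noteq> {} \<and> open \<Omega> \<and> connected \<Omega> \<and> bounded \<Omega>"

text \<open>Powers of extended nonnegative numbers; used for positive exponents only.\<close>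

definition epowr :: "ennreal \<Rightarrow> real \<Rightarrow> ennreal" where
  "epowr x r = (if x = \<infinity> then \<infinity> else ennreal (enn2real x powr r))"

section \<open>Curves and line integrals\<close>

text \<open>The triple \<open>(\<gamma>, a, b)\<close> stands for the curve \<open>\<gamma>\<close> restricted to \<open>{a..b}\<close>.\<close>

type_synonym 'a curve = "(real \<Rightarrow> 'a) \<times> real \<times> real"

definition curve_length :: "(real \<Rightarrow> 'a::metric_space) \<Rightarrow> real \<Rightarrow> real \<Rightarrow> ennreal" where
  "curve_length \<gamma> a b = (SUP ts \<in> {ts. sorted ts \<and> set ts \<subseteq> {a..b}}.
     \<Sum>i<length ts - 1. ennreal (dist (\<gamma> (ts ! i)) (\<gamma> (ts ! Suc i))))"

definition rectifiable_in :: "'a::metric_space set \<Rightarrow> 'a curve \<Rightarrow> bool" where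
  "rectifiable_in \<Omega> = (\<lambda>(\<gamma>, a, b). a \<le> b \<and> continuous_on {a..b} \<gamma> \<and> \<gamma> ` {a..b} \<subseteq> \<Omega> \<and>
     curve_length \<gamma> a b < \<infinity>)"

text \<open>Arc length parametrization of a rectifiable curve: the parameter \<open>s\<close> is sent to \<open>\<gamma> t\<close> for any
  \<open>t\<close> at which the length of \<open>\<gamma>\<close> on \<open>{a..t}\<close> is \<open>s\<close>; on the set of these \<open>t\<close> the curve is constant.\<close>

definition arc_param :: "(real \<Rightarrow> 'a::metric_space) \<Rightarrow> real \<Rightarrow> real \<Rightarrow> real \<Rightarrow> 'a" where
  "arc_param \<gamma> a b s = \<gamma> (SOME t. t \<in> {a..b} \<and> curve_length \<gamma> a t = ennreal s)"

definition line_integral :: "'a::metric_space curve \<Rightarrow> ('a \<Rightarrow> ennreal) \<Rightarrow> ennreal" where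
  "line_integral = (\<lambda>(\<gamma>, a, b) g.
     \<integral>\<^sup>+s\<in>{0..enn2real (curve_length \<gamma> a b)}. g (arc_param \<gamma> a b s) \<partial>lborel)"

text \<open>Only families of curves with compact parameter interval are needed below (exceptional families
  for weak upper gradients). For such curves local rectifiability and rectifiability coincide.\<close>

definition p_module :: "'a::metric_space measure \<Rightarrow> real \<Rightarrow> 'a curve set \<Rightarrow> ennreal" where
  "p_module M p \<Gamma> =
     (INF \<eta> \<in> {\<eta> \<in> borel_measurable borel. \<forall>c\<in>\<Gamma>. rectifiable_in UNIV c \<longrightarrow> line_integral c \<eta> \<ge> 1}.
        \<integral>\<^sup>+x. epowr (\<eta> x) p \<partial>M)"

section \<open>Upper gradients and function spaces\<close>

text \<open>A function on \<open>\<Omega>\<close> is a total function whose values outside \<open>\<Omega>\<close> are irrelevant.\<close>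

definition weak_upper_gradient ::
  "'a::metric_space measure \<Rightarrow> real \<Rightarrow> 'a set \<Rightarrow> ('a \<Rightarrow> real) \<Rightarrow> ('a \<Rightarrow> ennreal) \<Rightarrow> bool" where
  "weak_upper_gradient M p \<Omega> f g \<longleftrightarrow> g \<in> borel_measurable (restrict_space borel \<Omega>) \<and>
     (\<exists>\<Gamma>. p_module M p \<Gamma> = 0 \<and>
       (\<forall>\<gamma> a b. rectifiable_in \<Omega> (\<gamma>, a, b) \<longrightarrow> (\<gamma>, a, b) \<notin> \<Gamma> \<longrightarrow>
          ennreal \<bar>f (\<gamma> a) - f (\<gamma> b)\<bar> \<le> line_integral (\<gamma>, a, b) g))"

definition Lp_weak_upper_gradient ::
  "'a::metric_space measure \<Rightarrow> real \<Rightarrow> 'a set \<Rightarrow> ('a \<Rightarrow> real) \<Rightarrow> ('a \<Rightarrow> ennreal) \<Rightarrow> bool" where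
  "Lp_weak_upper_gradient M p \<Omega> f g \<longleftrightarrow>
     weak_upper_gradient M p \<Omega> f g \<and> (\<integral>\<^sup>+x\<in>\<Omega>. epowr (g x) p \<partial>M) < \<infinity>"

definition minimal_weak_upper_gradient ::
  "'a::metric_space measure \<Rightarrow> real \<Rightarrow> 'a set \<Rightarrow> ('a \<Rightarrow> real) \<Rightarrow> ('a \<Rightarrow> ennreal) \<Rightarrow> bool" where
  "minimal_weak_upper_gradient M p \<Omega> f g \<longleftrightarrow> Lp_weak_upper_gradient M p \<Omega> f g \<and>
     (\<forall>h. Lp_weak_upper_gradient M p \<Omega> f h \<longrightarrow> (AE x in M. x \<in> \<Omega> \<longrightarrow> g x \<le> h x))"

text \<open>For \<open>1 \<le> p\<close> a minimal weak upper gradient exists as soon as there is a weak upper gradient in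
  \<open>L\<^sup>p\<close>, and it is unique up to a null set; every use below is under that condition.\<close>

definition grad_min ::
  "'a::metric_space measure \<Rightarrow> real \<Rightarrow> 'a set \<Rightarrow> ('a \<Rightarrow> real) \<Rightarrow> 'a \<Rightarrow> ennreal" where
  "grad_min M p \<Omega> f = (SOME g. minimal_weak_upper_gradient M p \<Omega> f g)"

definition L1_loc :: "'a::metric_space measure \<Rightarrow> 'a set \<Rightarrow> ('a \<Rightarrow> real) set" where
  "L1_loc M \<Omega> = {f. \<forall>x\<in>\<Omega>. \<exists>r>0. set_integrable M (ball x r \<inter> \<Omega>) f}"

text \<open>The elements of \<open>N\<^sup>1\<^sup>,\<^sup>p\<close> and \<open>S\<^sup>1\<^sup>,\<^sup>p\<close> are honest functions, not classes modulo null sets. Since the weak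
  upper gradient inequality is imposed on the pointwise values along almost every curve, it already
  singles out the good representatives; two of them that agree almost everywhere agree outside an
  exceptional set of capacity zero.\<close>

definition N1 :: "'a::metric_space measure \<Rightarrow> real \<Rightarrow> 'a set \<Rightarrow> ('a \<Rightarrow> real) set" where
  "N1 M p \<Omega> = {f \<in> borel_measurable (restrict_space M \<Omega>).
     (\<integral>\<^sup>+x\<in>\<Omega>. ennreal (\<bar>f x\<bar> powr p) \<partial>M) < \<infinity> \<and> (\<exists>g. Lp_weak_upper_gradient M p \<Omega> f g)}"

definition S1 :: "'a::metric_space measure \<Rightarrow> real \<Rightarrow> 'a set \<Rightarrow> ('a \<Rightarrow> real) set" where
  "S1 M p \<Omega> = {f \<in> borel_measurable (restrict_space M \<Omega>).
     f \<in> L1_loc M \<Omega> \<and> (\<exists>g. Lp_weak_upper_gradient M p \<Omega> f g)}"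

definition S1_seminorm :: "'a::metric_space measure \<Rightarrow> real \<Rightarrow> 'a set \<Rightarrow> ('a \<Rightarrow> real) \<Rightarrow> ennreal" where
  "S1_seminorm M p \<Omega> f = epowr (\<integral>\<^sup>+x\<in>\<Omega>. epowr (grad_min M p \<Omega> f x) p \<partial>M) (1 / p)"

definition weak_Poincare :: "'a::metric_space measure \<Rightarrow> real \<Rightarrow> bool" where
  "weak_Poincare M p \<longleftrightarrow> (\<exists>\<sigma>>1. \<exists>C\<ge>0. \<forall>x r f g. r > 0 \<longrightarrow>
     set_integrable M (ball x (\<sigma> * r)) f \<longrightarrow> weak_upper_gradient M p (ball x (\<sigma> * r)) f g \<longrightarrow>
     (let fB = (LINT y:ball x r|M. f y) / measure M (ball x r) in
       (\<integral>\<^sup>+y\<in>ball x r. ennreal \<bar>f y - fB\<bar> \<partial>M) / emeasure M (ball x r)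
         \<le> ennreal (C * diameter (ball x r)) *
            epowr ((\<integral>\<^sup>+y\<in>ball x (\<sigma> * r). epowr (g y) p \<partial>M) / emeasure M (ball x (\<sigma> * r))) (1 / p)))"

section \<open>Composition operators\<close>

definition bimeasurable_homeomorphism ::
  "'a::metric_space measure \<Rightarrow> 'a set \<Rightarrow> 'a set \<Rightarrow> ('a \<Rightarrow> 'a) \<Rightarrow> bool" where
  "bimeasurable_homeomorphism M \<Omega> \<Omega>' \<phi> \<longleftrightarrow> (\<exists>\<psi>. homeomorphism \<Omega> \<Omega>' \<phi> \<psi>) \<and>
     (\<forall>A\<subseteq>\<Omega>. A \<in> null_sets M \<longrightarrow> \<phi> ` A \<in> null_sets M) \<and>
     (\<forall>A\<subseteq>\<Omega>'. A \<in> null_sets M \<longrightarrow> \<phi> -` A \<inter> \<Omega> \<in> null_sets M)"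

definition bounded_composition ::
  "'a::metric_space measure \<Rightarrow> real \<Rightarrow> real \<Rightarrow> 'a set \<Rightarrow> 'a set \<Rightarrow> ('a \<Rightarrow> 'a) \<Rightarrow> bool" where
  "bounded_composition M p q \<Omega> \<Omega>' \<phi> \<longleftrightarrow> (\<forall>f\<in>S1 M p \<Omega>'. f \<circ> \<phi> \<in> S1 M q \<Omega>) \<and>
     (\<exists>C\<ge>0. \<forall>f\<in>S1 M p \<Omega>'. S1_seminorm M q \<Omega> (f \<circ> \<phi>) \<le> ennreal C * S1_seminorm M p \<Omega>' f)"

section \<open>Capacity\<close>

definition C0 :: "'a::metric_space set \<Rightarrow> ('a \<Rightarrow> real) set" where
  "C0 \<Omega> = {u. continuous_on \<Omega> u \<and> compact (closure {x\<in>\<Omega>. u x \<noteq> 0}) \<and> closure {x\<in>\<Omega>. u x \<noteq> 0} \<subseteq> \<Omega>}"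

definition cap_compact :: "'a::metric_space measure \<Rightarrow> real \<Rightarrow> 'a set \<Rightarrow> 'a set \<Rightarrow> ennreal" where
  "cap_compact M p \<Omega> F = (INF u \<in> {u \<in> C0 \<Omega> \<inter> N1 M p \<Omega>. \<forall>x\<in>F. u x \<ge> 1}.
     \<integral>\<^sup>+x\<in>\<Omega>. epowr (grad_min M p \<Omega> u x) p \<partial>M)"

text \<open>On open sets, the inner capacity is the capacity by definition.\<close>

definition inner_cap :: "'a::metric_space measure \<Rightarrow> real \<Rightarrow> 'a set \<Rightarrow> 'a set \<Rightarrow> ennreal" where
  "inner_cap M p \<Omega> E = (SUP F \<in> {F. compact F \<and> F \<subseteq> E}. cap_compact M p \<Omega> F)"

definition outer_cap :: "'a::metric_space measure \<Rightarrow> real \<Rightarrow> 'a set \<Rightarrow> 'a set \<Rightarrow> ennreal" where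
  "outer_cap M p \<Omega> E = (INF U \<in> {U. open U \<and> E \<subseteq> U \<and> U \<subseteq> \<Omega>}. inner_cap M p \<Omega> U)"

definition cap_measurable :: "'a::metric_space measure \<Rightarrow> real \<Rightarrow> 'a set \<Rightarrow> 'a set \<Rightarrow> bool" where
  "cap_measurable M p \<Omega> E \<longleftrightarrow> inner_cap M p \<Omega> E = outer_cap M p \<Omega> E"

text \<open>The common value of inner and outer capacity, meaningful for capacity measurable sets.\<close>

definition capacity :: "'a::metric_space measure \<Rightarrow> real \<Rightarrow> 'a set \<Rightarrow> 'a set \<Rightarrow> ennreal" where
  "capacity M p \<Omega> E = outer_cap M p \<Omega> E"

end

theory Submission
  imports Defs
begin

text \<open>
  An admissible function \<open>u\<close> for the \<open>p\<close>-capacity of \<open>\<phi>(F)\<close> in \<open>\<Omega>'\<close> pulls back to the admissible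
  function \<open>u \<circ> \<phi>\<close> for the \<open>q\<close>-capacity of \<open>F\<close> in \<open>\<Omega>\<close>, because \<open>\<phi>\<close> is a homeomorphism and
  continuous functions of compact support are bounded, hence integrable to any power on a bounded
  domain. Thus \<open>u\<close> may be fed to the composition operator, and the operator bound, which compares
  exactly the energies that define the capacities, gives
  \<open>cap\<^sub>q(F; \<Omega>)\<^sup>1\<^sup>/\<^sup>q \<le> C cap\<^sub>p(\<phi>(F); \<Omega>')\<^sup>1\<^sup>/\<^sup>p\<close> for compact \<open>F\<close> (\<open>cap_compact_le\<close>).

  Homeomorphisms carry compact subsets of \<open>\<Omega>\<close> to compact subsets of \<open>\<Omega>'\<close> and pull open subsets
  back to open subsets, so this inequality passes to suprema over compact sets and then to infima
  over open sets (\<open>outer_cap_preimage_le\<close>). A set of vanishing outer capacity therefore has a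
  preimage of vanishing outer capacity, and the inner capacity lies below the outer one.
\<close>

section \<open>Powers of extended nonnegative numbers\<close>

lemma epowr_zero [simp]: "epowr 0 r = 0"
  by (simp add: epowr_def)

lemma epowr_mono: "0 < r \<Longrightarrow> x \<le> y \<Longrightarrow> epowr x r \<le> epowr y r"
  by (cases x; cases y) (auto simp: epowr_def powr_mono2 top_unique)

lemma epowr_epowr_inverse: "0 < r \<Longrightarrow> epowr (epowr x r) (1 / r) = x"
  by (cases x) (auto simp: epowr_def powr_powr)

lemma epowr_inverse_epowr: "0 < r \<Longrightarrow> epowr (epowr x (1 / r)) r = x"
  using epowr_epowr_inverse [of "1 / r" x] by simp

lemma epowr_le_iff: "0 < r \<Longrightarrow> epowr x (1 / r) \<le> y \<longleftrightarrow> x \<le> epowr y r"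
  by (metis epowr_mono epowr_epowr_inverse epowr_inverse_epowr zero_less_divide_1_iff)

text \<open>The function \<open>y \<mapsto> (C y\<^sup>1\<^sup>/\<^sup>p)\<^sup>q\<close> through which a \<open>q\<close>-energy is bounded by a \<open>p\<close>-energy.\<close>

definition energy_bound :: "real \<Rightarrow> real \<Rightarrow> real \<Rightarrow> ennreal \<Rightarrow> ennreal" where
  "energy_bound p q C y = epowr (ennreal C * epowr y (1 / p)) q"

lemma energy_bound_zero [simp]: "energy_bound p q C 0 = 0"
  by (simp add: energy_bound_def)

lemma energy_bound_mono:
  assumes "0 < p" "0 < q" "x \<le> y"
  shows "energy_bound p q C x \<le> energy_bound p q C y"
  using assms by (auto simp: energy_bound_def intro!: epowr_mono mult_left_mono)

text \<open>For \<open>C > 0\<close> the bound is an order isomorphism of \<open>[0, \<infinity>]\<close>, so it commutes with infima.\<close>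

lemma le_energy_bound_INF:
  assumes "0 < p" "0 < q" "0 < C" and le: "\<And>i. i \<in> I \<Longrightarrow> x \<le> energy_bound p q C (f i)"
  shows "x \<le> energy_bound p q C (INF i\<in>I. f i)"
proof -
  have adjoint: "x \<le> energy_bound p q C y \<longleftrightarrow> epowr (epowr x (1 / q) / ennreal C) p \<le> y" for y
  proof -
    have "x \<le> energy_bound p q C y \<longleftrightarrow> epowr x (1 / q) \<le> ennreal C * epowr y (1 / p)"
      using assms by (simp add: energy_bound_def epowr_le_iff)
    also have "\<dots> \<longleftrightarrow> epowr x (1 / q) / ennreal C \<le> epowr y (1 / p)"
    proof -
      have "ennreal C * (epowr x (1 / q) / ennreal C) = epowr x (1 / q)"
        using \<open>0 < C\<close> by (simp add: mult_divide_eq_ennreal ennreal_times_divide mult.commute [of "ennreal C"])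
      then show ?thesis
        using \<open>0 < C\<close> ennreal_mult_le_mult_iff [of "ennreal C" "epowr x (1 / q) / ennreal C"]
        by simp
    qed
    also have "\<dots> \<longleftrightarrow> epowr (epowr x (1 / q) / ennreal C) p \<le> y"
      using epowr_le_iff [of "1 / p" "epowr x (1 / q) / ennreal C" y] \<open>0 < p\<close> by simp
    finally show ?thesis .
  qed
  show ?thesis
    using le unfolding adjoint by (rule INF_greatest)
qed

section \<open>Compactly supported functions on bounded domains\<close>

lemma bounded_emeasure_finite:
  assumes "homogeneous_space M" "bounded A"
  shows "emeasure M A < top"
proof -
  obtain x :: 'a and r where r: "A \<subseteq> ball x r" "0 < r"
    using bounded_subset_ballD [OF \<open>bounded A\<close>] by blast
  have "ball x r \<in> sets M" "emeasure M (ball x r) < top"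
    using assms r by (auto simp: homogeneous_space_def doubling_space_def borel_regular_def)
  with r show ?thesis
    by (meson emeasure_mono le_less_trans)
qed

lemma open_in_sets:
  assumes "homogeneous_space M" "open A"
  shows "A \<in> sets M"
  using assms by (auto simp: homogeneous_space_def doubling_space_def borel_regular_def)

lemma C0_bounded:
  assumes "u \<in> C0 \<Omega>"
  obtains B where "0 \<le> B" "\<And>x. x \<in> \<Omega> \<Longrightarrow> \<bar>u x\<bar> \<le> B"
proof -
  let ?K = "closure {x\<in>\<Omega>. u x \<noteq> 0}"
  have "compact (u ` ?K)"
    using assms by (auto simp: C0_def intro: compact_continuous_image continuous_on_subset)
  then obtain B where B: "\<forall>x\<in>?K. \<bar>u x\<bar> \<le> B"
    using compact_imp_bounded bounded_iff by (metis image_eqI real_norm_def)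
  have "\<bar>u x\<bar> \<le> max B 0" if "x \<in> \<Omega>" for x
    using B that closure_subset [of "{x\<in>\<Omega>. u x \<noteq> 0}"] by (cases "u x = 0") fastforce+
  then show ?thesis
    using that [of "max B 0"] by auto
qed

lemma C0_N1_imp_S1:
  assumes M: "homogeneous_space M" and \<Omega>: "bounded_domain \<Omega>" and u: "u \<in> C0 \<Omega>" "u \<in> N1 M p \<Omega>"
  shows "u \<in> S1 M p \<Omega>"
proof -
  have sets_\<Omega>: "open \<Omega>" "\<Omega> \<in> sets M" and fin: "emeasure M \<Omega> < top"
    using \<Omega> M by (auto simp: bounded_domain_def bounded_emeasure_finite open_in_sets)
  have meas: "u \<in> borel_measurable (restrict_space M \<Omega>)"
    using u by (simp add: N1_def)
  obtain B where B: "\<And>x. x \<in> \<Omega> \<Longrightarrow> \<bar>u x\<bar> \<le> B"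
    using C0_bounded [OF u(1)] by blast
  have "integrable (restrict_space M \<Omega>) u"
  proof (rule finite_measure.integrable_const_bound [where B = B])
    show "finite_measure (restrict_space M \<Omega>)"
      using sets_\<Omega> fin
      by (intro finite_measureI) (simp add: space_restrict_space emeasure_restrict_space sets.Int_space_eq2)
    show "AE x in restrict_space M \<Omega>. norm (u x) \<le> B"
      using B by (intro AE_I2) (auto simp: space_restrict_space)
  qed (fact meas)
  then have int: "set_integrable M \<Omega> u"
    using sets_\<Omega> by (simp add: integrable_restrict_space set_integrable_def sets.Int_space_eq2)
  have "u \<in> L1_loc M \<Omega>"
    unfolding L1_loc_def
  proof (intro CollectI ballI exI conjI)
    fix x show "set_integrable M (ball x 1 \<inter> \<Omega>) u"
      by (rule set_integrable_subset [OF int]) (use M sets_\<Omega> in \<open>auto intro: open_in_sets\<close>)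
  qed simp
  with u meas show ?thesis
    by (simp add: S1_def N1_def)
qed

lemma C0_S1_imp_N1:
  assumes M: "homogeneous_space M" and \<Omega>: "bounded_domain \<Omega>" and u: "u \<in> C0 \<Omega>" "u \<in> S1 M p \<Omega>"
    and "0 \<le> p"
  shows "u \<in> N1 M p \<Omega>"
proof -
  have \<Omega>': "\<Omega> \<in> sets M" and fin: "emeasure M \<Omega> < top"
    using \<Omega> M by (auto simp: bounded_domain_def bounded_emeasure_finite open_in_sets)
  obtain B where B: "\<And>x. x \<in> \<Omega> \<Longrightarrow> \<bar>u x\<bar> \<le> B"
    using C0_bounded [OF u(1)] by blast
  have "(\<integral>\<^sup>+x\<in>\<Omega>. ennreal (\<bar>u x\<bar> powr p) \<partial>M) \<le> (\<integral>\<^sup>+x\<in>\<Omega>. ennreal (B powr p) \<partial>M)"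
    using B \<open>0 \<le> p\<close>
    by (intro nn_integral_mono) (auto simp: indicator_def intro!: ennreal_leI powr_mono2)
  also have "\<dots> < \<infinity>"
    using \<Omega>' fin by (simp add: nn_integral_cmult_indicator ennreal_mult_less_top)
  finally show ?thesis
    using u by (simp add: S1_def N1_def)
qed

lemma C0_comp_homeomorphism:
  assumes h: "homeomorphism \<Omega> \<Omega>' \<phi> \<psi>" and u: "u \<in> C0 \<Omega>'"
  shows "u \<circ> \<phi> \<in> C0 \<Omega>"
proof -
  let ?K = "closure {y\<in>\<Omega>'. u y \<noteq> 0}"
  let ?S = "{x\<in>\<Omega>. (u \<circ> \<phi>) x \<noteq> 0}"
  have K: "compact ?K" "?K \<subseteq> \<Omega>'" and cont: "continuous_on \<Omega>' u"
    using u by (auto simp: C0_def)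
  have \<psi>K: "compact (\<psi> ` ?K)" "\<psi> ` ?K \<subseteq> \<Omega>"
    using K h by (auto simp: homeomorphism_def intro: compact_continuous_image continuous_on_subset)
  have "?S \<subseteq> \<psi> ` ?K"
  proof
    fix x assume "x \<in> ?S"
    then have "\<phi> x \<in> ?K" "x = \<psi> (\<phi> x)"
      using h closure_subset [of "{y\<in>\<Omega>'. u y \<noteq> 0}"] by (auto simp: homeomorphism_def)
    then show "x \<in> \<psi> ` ?K" by blast
  qed
  then have "closure ?S \<subseteq> \<psi> ` ?K"
    using \<psi>K(1) by (simp add: closure_minimal compact_imp_closed)
  then have "closure ?S \<subseteq> \<Omega>" "compact (closure ?S)"
    using \<psi>K compact_Int_closed [OF \<psi>K(1) closed_closure [of ?S]] by (auto simp: inf.absorb2)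
  moreover have "continuous_on \<Omega> (u \<circ> \<phi>)"
    using h cont by (intro continuous_on_compose) (auto simp: homeomorphism_def)
  ultimately show ?thesis
    by (simp add: C0_def)
qed

section \<open>Capacities under composition\<close>

text \<open>The seminorms of \<open>S\<^sup>1\<^sup>,\<^sup>p\<close> are roots of the energies that define the capacity, so the operator
  bound is a bound between energies. The constant is enlarged to be positive, which makes the
  bound invertible.\<close>

lemma bounded_composition_energy:
  assumes "bounded_composition M p q \<Omega> \<Omega>' \<phi>" "0 < q"
  obtains C where "0 < C" "\<And>f. f \<in> S1 M p \<Omega>' \<Longrightarrow>
    (\<integral>\<^sup>+x\<in>\<Omega>. epowr (grad_min M q \<Omega> (f \<circ> \<phi>) x) q \<partial>M)
      \<le> energy_bound p q C (\<integral>\<^sup>+x\<in>\<Omega>'. epowr (grad_min M p \<Omega>' f x) p \<partial>M)"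
proof -
  obtain C where C: "0 \<le> C" "\<And>f. f \<in> S1 M p \<Omega>' \<Longrightarrow>
      S1_seminorm M q \<Omega> (f \<circ> \<phi>) \<le> ennreal C * S1_seminorm M p \<Omega>' f"
    using assms by (auto simp: bounded_composition_def)
  show ?thesis
  proof (rule that [of "C + 1"])
    fix f assume f: "f \<in> S1 M p \<Omega>'"
    have "S1_seminorm M q \<Omega> (f \<circ> \<phi>) \<le> ennreal (C + 1) * S1_seminorm M p \<Omega>' f"
      using C(2) [OF f] by (rule order_trans) (intro mult_right_mono ennreal_leI, auto)
    then show "(\<integral>\<^sup>+x\<in>\<Omega>. epowr (grad_min M q \<Omega> (f \<circ> \<phi>) x) q \<partial>M)
        \<le> energy_bound p q (C + 1) (\<integral>\<^sup>+x\<in>\<Omega>'. epowr (grad_min M p \<Omega>' f x) p \<partial>M)"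
      using \<open>0 < q\<close> by (simp add: S1_seminorm_def energy_bound_def epowr_le_iff)
  qed (use C in simp)
qed

text \<open>Every competitor for \<open>\<phi>(F)\<close> composed with \<open>\<phi>\<close> is a competitor for \<open>F\<close>.\<close>

lemma cap_compact_le:
  assumes "0 < p" "0 < q" "homogeneous_space M" "bounded_domain \<Omega>" "bounded_domain \<Omega>'"
    and h: "homeomorphism \<Omega> \<Omega>' \<phi> \<psi>" and comp: "\<And>f. f \<in> S1 M p \<Omega>' \<Longrightarrow> f \<circ> \<phi> \<in> S1 M q \<Omega>"
    and "0 < C" and C: "\<And>f. f \<in> S1 M p \<Omega>' \<Longrightarrow>
      (\<integral>\<^sup>+x\<in>\<Omega>. epowr (grad_min M q \<Omega> (f \<circ> \<phi>) x) q \<partial>M)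
        \<le> energy_bound p q C (\<integral>\<^sup>+x\<in>\<Omega>'. epowr (grad_min M p \<Omega>' f x) p \<partial>M)"
  shows "cap_compact M q \<Omega> F \<le> energy_bound p q C (cap_compact M p \<Omega>' (\<phi> ` F))"
  unfolding cap_compact_def [of M p]
proof (rule le_energy_bound_INF)
  fix u assume u: "u \<in> {u \<in> C0 \<Omega>' \<inter> N1 M p \<Omega>'. \<forall>y\<in>\<phi> ` F. 1 \<le> u y}"
  then have S1: "u \<in> S1 M p \<Omega>'"
    using assms by (auto intro: C0_N1_imp_S1)
  have "u \<circ> \<phi> \<in> C0 \<Omega>"
    using u h by (auto intro: C0_comp_homeomorphism)
  moreover from this have "u \<circ> \<phi> \<in> N1 M q \<Omega>"
    using assms comp [OF S1] by (auto intro: C0_S1_imp_N1)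
  ultimately have "cap_compact M q \<Omega> F \<le> (\<integral>\<^sup>+x\<in>\<Omega>. epowr (grad_min M q \<Omega> (u \<circ> \<phi>) x) q \<partial>M)"
    using u unfolding cap_compact_def by (intro INF_lower) auto
  also note C [OF S1]
  finally show "cap_compact M q \<Omega> F
      \<le> energy_bound p q C (\<integral>\<^sup>+x\<in>\<Omega>'. epowr (grad_min M p \<Omega>' u x) p \<partial>M)" .
qed (use assms in auto)

lemma inner_cap_preimage_le:
  assumes "0 < p" "0 < q" "homeomorphism \<Omega> \<Omega>' \<phi> \<psi>"
    and le: "\<And>F. cap_compact M q \<Omega> F \<le> energy_bound p q C (cap_compact M p \<Omega>' (\<phi> ` F))"
  shows "inner_cap M q \<Omega> (\<phi> -` A \<inter> \<Omega>) \<le> energy_bound p q C (inner_cap M p \<Omega>' A)"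
  unfolding inner_cap_def [of M q]
proof (rule SUP_least)
  fix F assume F: "F \<in> {F. compact F \<and> F \<subseteq> \<phi> -` A \<inter> \<Omega>}"
  then have "compact (\<phi> ` F)" "\<phi> ` F \<subseteq> A"
    using assms(3)
    by (auto simp: homeomorphism_def intro: compact_continuous_image continuous_on_subset)
  then have "cap_compact M p \<Omega>' (\<phi> ` F) \<le> inner_cap M p \<Omega>' A"
    unfolding inner_cap_def by (intro SUP_upper) auto
  then show "cap_compact M q \<Omega> F \<le> energy_bound p q C (inner_cap M p \<Omega>' A)"
    using le [of F] energy_bound_mono assms(1,2) order_trans by blast
qed

lemma outer_cap_preimage_le:
  assumes "0 < p" "0 < q" "0 < C" "open \<Omega>" "homeomorphism \<Omega> \<Omega>' \<phi> \<psi>"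
    and le: "\<And>F. cap_compact M q \<Omega> F \<le> energy_bound p q C (cap_compact M p \<Omega>' (\<phi> ` F))"
  shows "outer_cap M q \<Omega> (\<phi> -` E \<inter> \<Omega>) \<le> energy_bound p q C (outer_cap M p \<Omega>' E)"
  unfolding outer_cap_def [of M p]
proof (rule le_energy_bound_INF)
  fix U assume U: "U \<in> {U. open U \<and> E \<subseteq> U \<and> U \<subseteq> \<Omega>'}"
  have "open (\<phi> -` U \<inter> \<Omega>)"
    using assms(4,5) U continuous_on_open_vimage [of \<Omega> \<phi>] by (auto simp: homeomorphism_def)
  then have "outer_cap M q \<Omega> (\<phi> -` E \<inter> \<Omega>) \<le> inner_cap M q \<Omega> (\<phi> -` U \<inter> \<Omega>)"
    using U unfolding outer_cap_def by (intro INF_lower) auto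
  also have "\<dots> \<le> energy_bound p q C (inner_cap M p \<Omega>' U)"
    using assms by (intro inner_cap_preimage_le)
  finally show "outer_cap M q \<Omega> (\<phi> -` E \<inter> \<Omega>) \<le> energy_bound p q C (inner_cap M p \<Omega>' U)" .
qed (use assms in auto)

lemma inner_cap_le_outer_cap: "inner_cap M p \<Omega> E \<le> outer_cap M p \<Omega> E"
  unfolding outer_cap_def
  by (rule INF_greatest) (auto simp: inner_cap_def intro!: SUP_subset_mono)

theorem corollary3p2:
  fixes M :: "'a::metric_space measure"
    and \<Omega> \<Omega>' E :: "'a set"
    and \<phi> :: "'a \<Rightarrow> 'a"
    and p q :: real
  assumes "1 < q" and "q \<le> p"
    and "homogeneous_space M" and "weak_Poincare M p"
    and "bounded_domain \<Omega>" and "bounded_domain \<Omega>'"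
    and "bimeasurable_homeomorphism M \<Omega> \<Omega>' \<phi>"
    and "bounded_composition M p q \<Omega> \<Omega>' \<phi>"
    and "E \<subseteq> \<Omega>'"
    and "cap_measurable M p \<Omega>' E" and "capacity M p \<Omega>' E = 0"
  shows "cap_measurable M q \<Omega> (\<phi> -` E \<inter> \<Omega>) \<and> capacity M q \<Omega> (\<phi> -` E \<inter> \<Omega>) = 0"
proof -
  have pq: "0 < p" "0 < q"
    using assms(1,2) by auto
  obtain \<psi> where h: "homeomorphism \<Omega> \<Omega>' \<phi> \<psi>"
    using assms(7) by (auto simp: bimeasurable_homeomorphism_def)
  have comp: "f \<circ> \<phi> \<in> S1 M q \<Omega>" if "f \<in> S1 M p \<Omega>'" for f
    using assms(8) that by (simp add: bounded_composition_def)
  obtain C where C: "0 < C" "\<And>f. f \<in> S1 M p \<Omega>' \<Longrightarrow>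
      (\<integral>\<^sup>+x\<in>\<Omega>. epowr (grad_min M q \<Omega> (f \<circ> \<phi>) x) q \<partial>M)
        \<le> energy_bound p q C (\<integral>\<^sup>+x\<in>\<Omega>'. epowr (grad_min M p \<Omega>' f x) p \<partial>M)"
    using bounded_composition_energy [OF assms(8) pq(2)] by blast
  have "outer_cap M q \<Omega> (\<phi> -` E \<inter> \<Omega>) \<le> energy_bound p q C (outer_cap M p \<Omega>' E)"
    using assms(5) cap_compact_le [OF pq assms(3,5,6) h comp C]
    by (intro outer_cap_preimage_le [OF pq C(1) _ h]) (auto simp: bounded_domain_def)
  also have "\<dots> = 0"
    using assms(11) by (simp add: capacity_def)
  finally have "outer_cap M q \<Omega> (\<phi> -` E \<inter> \<Omega>) = 0"
    by simp
  then show ?thesis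
    using inner_cap_le_outer_cap [of M q \<Omega> "\<phi> -` E \<inter> \<Omega>"]
    by (simp add: cap_measurable_def capacity_def)
qed

end
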